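(* Let $e\ge 3$, $I=\{0,\dots,e-1\}=\mathbb Z/e\mathbb Z$, $k\in I$, $\ell\ge1$, $\boldsymbol\kappa\in I^\ell$, let $\boldsymbol\lambda$ be a $k$-horizontal $\ell$-partition (residues with respect to $\boldsymbol\kappa$ modulo $e$), let $T$ be a row-standard $\boldsymbol\lambda$-tableau, and let $\boldsymbol\mu=\Phi_k(\boldsymbol\lambda)$. Then the $\boldsymbol\mu$-tableau $T'$ obtained from $T$ by subdivision is row-standard. Moreover, if $T$ is standard, then $T'$ is standard.
   Context: Nodes of an $\ell$-partition $\boldsymbol\lambda=(\boldsymbol\lambda^{(1)},\dots,\boldsymbol\lambda^{(\ell)})$ are triples $(m,r,c)$ (component, row, column), with residue $\kappa_m+c-r \bmod e$; a $k$-node is a node of residue $k$. $\boldsymbol\lambda$ is *$k$-horizontal* if in no component $m$ there is $r$ with $(m,r,1),(m,r+1,1)\in[\boldsymbol\lambda]$ and $\operatorname{res}(m,r,1)\equiv k+1\pmod e$. For $k$-horizontal $\boldsymbol\lambda$, $\boldsymbol\mu=\Phi_k(\boldsymbol\lambda)$ is the $\ell$-partition obtained by inserting a new node immediately to the right of every $k$-node of $[\boldsymbol\lambda]$; i.e. $\boldsymbol\mu^{(m)}_r=\boldsymbol\lambda^{(m)}_r+\#\{k\text{-nodes in row } r \text{ of component } m\}$. For $A=(m,r,c)\in[\boldsymbol\lambda]$ let $A^+=(m,r,c+p)\in[\boldsymbol\mu]$, where $p$ is the number of $k$-nodes $(m,r,x)$ with $x<c$; if $A$ is a $k$-node let $A^\sharp$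 be the node immediately to the right of $A^+$. Every node of $[\boldsymbol\mu]$ is exactly one of these. A $\boldsymbol\lambda$-tableau is a bijection $T:[\boldsymbol\lambda]\to\{1,\dots,n\}$, $n=|\boldsymbol\lambda|$; it is row-standard if entries increase strictly from left to right along rows in each component, and standard if in addition they increase strictly from top to bottom along columns. Let $\phi^T(t)=t+\#\{1\le j<t\mid \operatorname{res}(T^{-1}(j))=k\}$. The subdivided tableau $T'$ is the $\boldsymbol\mu$-tableau with $T'(A^+)=\phi^T(T(A))$ for all $A\in[\boldsymbol\lambda]$ and $T'(A^\sharp)=\phi^T(T(A))+1$ for all $k$-nodes $A\in[\boldsymbol\lambda]$. *)

theory Defs
  imports Main "HOL-Number_Theory.Cong"
begin

text \<open>Nodes are triples (component, row, column); all three coordinates count from 1.\<close>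

type_synonym node = "nat \<times> nat \<times> nat"

text \<open>
  A multipartition is encoded by its parts: \<open>lam m r\<close> is the \<open>r\<close>-th part of the \<open>m\<close>-th component.
  Indices outside \<open>m \<in> {1..l}\<close>, \<open>r \<ge> 1\<close> carry the value 0, so that different functions are
  different multipartitions and the Young diagram need not mention \<open>l\<close>.
\<close>

type_synonym parts = "nat \<Rightarrow> nat \<Rightarrow> nat"

definition multipartition :: "nat \<Rightarrow> parts \<Rightarrow> bool" where
  "multipartition l lam \<longleftrightarrow>
     (\<forall>m r. lam m r \<noteq> 0 \<longrightarrow> 1 \<le> m \<and> m \<le> l \<and> 1 \<le> r) \<and>
     (\<forall>m r. 1 \<le> r \<longrightarrow> lam m (r + 1) \<le> lam m r) \<and>
     finite {(m, r). lam m r \<noteq> 0}"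

definition mp_size :: "parts \<Rightarrow> nat" where
  "mp_size lam = (\<Sum>(m, r) \<in> {(m, r). lam m r \<noteq> 0}. lam m r)"

definition nodes :: "parts \<Rightarrow> node set" where
  "nodes lam = {(m, r, c). 1 \<le> c \<and> c \<le> lam m r}"

text \<open>\<open>\<int>/e\<int>\<close> is represented by the integers \<open>{0..<e}\<close>.\<close>

definition residue :: "nat \<Rightarrow> (nat \<Rightarrow> int) \<Rightarrow> node \<Rightarrow> int" where
  "residue e kappa = (\<lambda>(m, r, c). (kappa m + int c - int r) mod int e)"

definition k_nodes :: "nat \<Rightarrow> (nat \<Rightarrow> int) \<Rightarrow> int \<Rightarrow> parts \<Rightarrow> node set" where
  "k_nodes e kappa k lam = {A \<in> nodes lam. residue e kappa A = k}"

definition k_horizontal :: "nat \<Rightarrow> (nat \<Rightarrow> int) \<Rightarrow> int \<Rightarrow> parts \<Rightarrow> bool" where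
  "k_horizontal e kappa k lam \<longleftrightarrow>
     \<not> (\<exists>m r. (m, r, 1) \<in> nodes lam \<and> (m, r + 1, 1) \<in> nodes lam \<and>
          [residue e kappa (m, r, 1) = k + 1] (mod int e))"

definition Phi :: "nat \<Rightarrow> (nat \<Rightarrow> int) \<Rightarrow> int \<Rightarrow> parts \<Rightarrow> parts" where
  "Phi e kappa k lam = (\<lambda>m r. lam m r + card {c. (m, r, c) \<in> k_nodes e kappa k lam})"

text \<open>The nodes \<open>A\<^sup>+\<close> and \<open>A\<^sup>\<sharp>\<close>; the latter is only meaningful for \<open>k\<close>-nodes.\<close>

definition plus_node :: "nat \<Rightarrow> (nat \<Rightarrow> int) \<Rightarrow> int \<Rightarrow> parts \<Rightarrow> node \<Rightarrow> node" where
  "plus_node e kappa k lam =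
     (\<lambda>(m, r, c). (m, r, c + card {x. (m, r, x) \<in> k_nodes e kappa k lam \<and> x < c}))"

definition sharp_node :: "nat \<Rightarrow> (nat \<Rightarrow> int) \<Rightarrow> int \<Rightarrow> parts \<Rightarrow> node \<Rightarrow> node" where
  "sharp_node e kappa k lam A = (case plus_node e kappa k lam A of (m, r, c) \<Rightarrow> (m, r, c + 1))"

text \<open>A tableau is a function on all triples, of which only the values on the diagram matter.\<close>

definition tableau :: "parts \<Rightarrow> (node \<Rightarrow> nat) \<Rightarrow> bool" where
  "tableau lam T \<longleftrightarrow> bij_betw T (nodes lam) {1..mp_size lam}"

definition row_standard :: "parts \<Rightarrow> (node \<Rightarrow> nat) \<Rightarrow> bool" where
  "row_standard lam T \<longleftrightarrow> tableau lam T \<and>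
     (\<forall>m r c c'. (m, r, c) \<in> nodes lam \<and> (m, r, c') \<in> nodes lam \<and> c < c' \<longrightarrow>
        T (m, r, c) < T (m, r, c'))"

definition standard :: "parts \<Rightarrow> (node \<Rightarrow> nat) \<Rightarrow> bool" where
  "standard lam T \<longleftrightarrow> row_standard lam T \<and>
     (\<forall>m r r' c. (m, r, c) \<in> nodes lam \<and> (m, r', c) \<in> nodes lam \<and> r < r' \<longrightarrow>
        T (m, r, c) < T (m, r', c))"

definition phi :: "nat \<Rightarrow> (nat \<Rightarrow> int) \<Rightarrow> int \<Rightarrow> parts \<Rightarrow> (node \<Rightarrow> nat) \<Rightarrow> nat \<Rightarrow> nat" where
  "phi e kappa k lam T t =
     t + card {j. 1 \<le> j \<and> j < t \<and> residue e kappa (inv_into (nodes lam) T j) = k}"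

text \<open>
  The subdivided tableau. The description determines a unique value at every node of
  \<open>Phi e kappa k lam\<close>: see \<open>nodes_Phi\<close>, \<open>subdivide_plus_node\<close> and \<open>subdivide_sharp_node\<close> below.
\<close>

definition subdivide ::
  "nat \<Rightarrow> (nat \<Rightarrow> int) \<Rightarrow> int \<Rightarrow> parts \<Rightarrow> (node \<Rightarrow> nat) \<Rightarrow> node \<Rightarrow> nat" where
  "subdivide e kappa k lam T B = (THE v.
     (\<exists>A \<in> nodes lam. B = plus_node e kappa k lam A \<and> v = phi e kappa k lam T (T A)) \<or>
     (\<exists>A \<in> k_nodes e kappa k lam.
        B = sharp_node e kappa k lam A \<and> v = phi e kappa k lam T (T A) + 1))"


lemma finite_row [simp]: "finite {c. (m, r, c) \<in> k_nodes e kappa k lam \<and> P c}"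
  by (rule finite_subset[of _ "{..lam m r}"]) (auto simp: k_nodes_def nodes_def)

lemma finite_row' [simp]: "finite {c. (m, r, c) \<in> k_nodes e kappa k lam}"
  using finite_row[where P = "\<lambda>_. True"] by simp

lemma plus_node_Suc:
  "\<exists>f. (\<forall>c. plus_node e kappa k lam (m, r, c) = (m, r, f c)) \<and>
     (\<forall>c. f (Suc c) = (if (m, r, c) \<in> k_nodes e kappa k lam then f c + 2 else f c + 1)) \<and>
     f 0 = 0 \<and> f (Suc (lam m r)) = Suc (Phi e kappa k lam m r)"
proof -
  define S where "S c = {x. (m, r, x) \<in> k_nodes e kappa k lam \<and> x < c}" for c
  have fin: "finite (S c)" for c
    unfolding S_def by simp
  have "S (Suc c) = (if (m, r, c) \<in> k_nodes e kappa k lam then insert c (S c) else S c)" for c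
    by (auto simp: S_def less_Suc_eq)
  moreover have "c \<notin> S c" for c by (simp add: S_def)
  ultimately have step: "card (S (Suc c)) =
      (if (m, r, c) \<in> k_nodes e kappa k lam then Suc (card (S c)) else card (S c))" for c
    using fin by simp
  have "S (Suc (lam m r)) = {c. (m, r, c) \<in> k_nodes e kappa k lam}"
    by (auto simp: S_def k_nodes_def nodes_def)
  moreover have "S 0 = {}" by (simp add: S_def)
  ultimately show ?thesis
    using step by (intro exI[of _ "\<lambda>c. c + card (S c)"]) (auto simp: plus_node_def S_def Phi_def)
qed

lemma plus_node_less:
  assumes "c < c'"
  shows "\<exists>j j'. plus_node e kappa k lam (m, r, c) = (m, r, j) \<and>
     plus_node e kappa k lam (m, r, c') = (m, r, j') \<and> j < j' \<and>
     ((m, r, c) \<in> k_nodes e kappa k lam \<longrightarrow> j + 1 < j')"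
proof -
  obtain f where f: "\<And>c. plus_node e kappa k lam (m, r, c) = (m, r, f c)"
    "\<And>c. f (Suc c) = (if (m, r, c) \<in> k_nodes e kappa k lam then f c + 2 else f c + 1)"
    using plus_node_Suc by metis
  have "strict_mono f"
    unfolding strict_mono_Suc_iff by (simp add: f(2))
  then have "f (Suc c) \<le> f c'"
    using assms by (simp add: strict_mono_less_eq)
  then show ?thesis
    using f by (auto split: if_splits)
qed

lemma inj_plus_node: "inj (plus_node e kappa k lam)"
proof (rule injI)
  fix A B assume eq: "plus_node e kappa k lam A = plus_node e kappa k lam B"
  obtain m r c where A: "A = (m, r, c)" by (cases A)
  obtain m' r' c' where B: "B = (m', r', c')" by (cases B)
  have [simp]: "m' = m" "r' = r" using eq by (auto simp: A B plus_node_def)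
  have "c = c'"
    using eq plus_node_less[of c c' e kappa k lam m r] plus_node_less[of c' c e kappa k lam m r]
    by (cases c c' rule: linorder_cases) (auto simp: A B)
  then show "A = B" by (simp add: A B)
qed

lemma inj_sharp_node: "inj (sharp_node e kappa k lam)"
proof (rule injI)
  fix A B assume "sharp_node e kappa k lam A = sharp_node e kappa k lam B"
  then have "plus_node e kappa k lam A = plus_node e kappa k lam B"
    by (auto simp: sharp_node_def split: prod.splits)
  then show "A = B" by (rule injD[OF inj_plus_node])
qed

lemma plus_node_neq_sharp_node:
  assumes "B \<in> k_nodes e kappa k lam"
  shows "plus_node e kappa k lam A \<noteq> sharp_node e kappa k lam B"
proof
  assume eq: "plus_node e kappa k lam A = sharp_node e kappa k lam B"
  obtain m r c where A: "A = (m, r, c)" by (cases A)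
  obtain m' r' c' where B: "B = (m', r', c')" by (cases B)
  have [simp]: "m' = m" "r' = r" using eq by (auto simp: A B plus_node_def sharp_node_def)
  show False
    using eq assms plus_node_less[of c c' e kappa k lam m r]
      plus_node_less[of c' c e kappa k lam m r]
    by (cases c c' rule: linorder_cases) (auto simp: A B sharp_node_def split: prod.splits)
qed

lemma nodes_Phi:
  "nodes (Phi e kappa k lam) =
     plus_node e kappa k lam ` nodes lam \<union> sharp_node e kappa k lam ` k_nodes e kappa k lam"
  (is "_ = ?P ` _ \<union> ?S ` ?K")
proof (rule set_eqI)
  fix B :: node
  obtain m r j where B: "B = (m, r, j)" by (cases B)
  obtain f where f: "\<And>c. ?P (m, r, c) = (m, r, f c)"
    "\<And>c. f (Suc c) = (if (m, r, c) \<in> ?K then f c + 2 else f c + 1)" "f 0 = 0"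
    "f (Suc (lam m r)) = Suc (Phi e kappa k lam m r)"
    using plus_node_Suc by metis
  have K0: "(m, r, 0) \<notin> ?K" by (simp add: k_nodes_def nodes_def)
  have "(1 \<le> j \<and> j < f (Suc n)) \<longleftrightarrow>
      (\<exists>c. 1 \<le> c \<and> c \<le> n \<and> (j = f c \<or> (m, r, c) \<in> ?K \<and> j = f c + 1))" for n
  proof (induction n)
    case 0
    then show ?case using K0 f(2)[of 0] f(3) by auto
  next
    case (Suc n)
    have "f (Suc n) \<ge> 1" using f(2)[of n] by (simp split: if_splits)
    then have "(1 \<le> j \<and> j < f (Suc (Suc n))) \<longleftrightarrow>
      (1 \<le> j \<and> j < f (Suc n)) \<or> j = f (Suc n) \<or> (m, r, Suc n) \<in> ?K \<and> j = f (Suc n) + 1"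
      using f(2)[of "Suc n"] by auto
    then show ?case unfolding Suc.IH by (auto simp: le_Suc_eq)
  qed
  from this[of "lam m r"] have "B \<in> nodes (Phi e kappa k lam) \<longleftrightarrow>
      (\<exists>c. 1 \<le> c \<and> c \<le> lam m r \<and> (j = f c \<or> (m, r, c) \<in> ?K \<and> j = f c + 1))"
    by (simp add: B nodes_def f(4) less_Suc_eq_le)
  also have "\<dots> \<longleftrightarrow> (\<exists>c. (m, r, c) \<in> nodes lam \<and> B = ?P (m, r, c)) \<or>
      (\<exists>c. (m, r, c) \<in> ?K \<and> B = ?S (m, r, c))"
    by (auto simp: B f(1) sharp_node_def nodes_def k_nodes_def)
  also have "\<dots> \<longleftrightarrow> B \<in> ?P ` nodes lam \<union> ?S ` ?K"
    by (auto simp: B plus_node_def sharp_node_def image_iff Bex_def split: prod.splits)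
  finally show "B \<in> nodes (Phi e kappa k lam) \<longleftrightarrow> B \<in> ?P ` nodes lam \<union> ?S ` ?K" .
qed

lemma subdivide_plus_node:
  assumes "A \<in> nodes lam"
  shows "subdivide e kappa k lam T (plus_node e kappa k lam A) = phi e kappa k lam T (T A)"
  unfolding subdivide_def
  using assms plus_node_neq_sharp_node inj_plus_node
  by (intro the_equality) (blast dest: injD)+

lemma subdivide_sharp_node:
  assumes "A \<in> k_nodes e kappa k lam"
  shows "subdivide e kappa k lam T (sharp_node e kappa k lam A) = phi e kappa k lam T (T A) + 1"
  unfolding subdivide_def
  using assms plus_node_neq_sharp_node[symmetric] inj_sharp_node
  by (intro the_equality) (blast dest: injD)+

lemma card_nodes:
  assumes "multipartition l lam"
  shows "finite (nodes lam)" and "card (nodes lam) = mp_size lam"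
proof -
  let ?R = "{(m, r). lam m r \<noteq> 0}"
  let ?h = "\<lambda>((m, r), c). (m, r, c) :: node"
  have fin: "finite ?R" using assms by (simp add: multipartition_def)
  have eq: "nodes lam = ?h ` (SIGMA x : ?R. {1..case x of (m, r) \<Rightarrow> lam m r})"
    by (force simp: nodes_def image_iff)
  have inj: "inj_on ?h X" for X by (auto simp: inj_on_def)
  show "finite (nodes lam)" unfolding eq using fin by auto
  show "card (nodes lam) = mp_size lam"
    unfolding eq card_image[OF inj] mp_size_def using fin by (simp add: split_def)
qed

lemma multipartition_Phi:
  assumes mp: "multipartition l lam" and hor: "k_horizontal e kappa k lam"
    and k: "0 \<le> k" "k < int e"
  shows "multipartition l (Phi e kappa k lam)"
proof -
  let ?K = "\<lambda>m r. {c. (m, r, c) \<in> k_nodes e kappa k lam}"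
  have empty: "Phi e kappa k lam m r \<noteq> 0 \<longleftrightarrow> lam m r \<noteq> 0" for m r
    by (auto simp: Phi_def k_nodes_def nodes_def)
  have le: "card (?K m (r + 1)) \<le> card (?K m r)" if "1 \<le> r" for m r
  proof -
    have lam: "lam m (r + 1) \<le> lam m r" using mp that by (simp add: multipartition_def)
    have "?K m (r + 1) \<subseteq> Suc ` ?K m r"
    proof
      fix c assume c: "c \<in> ?K m (r + 1)"
      then have c': "1 \<le> c" "c \<le> lam m (r + 1)" "(kappa m + int c - int r - 1) mod int e = k"
        by (auto simp: k_nodes_def nodes_def residue_def algebra_simps)
      have "c \<noteq> 1"
      proof
        assume "c = 1"
        then have "[kappa m - int r = k] (mod int e)" using c'(3) k by (simp add: cong_def)
        then have "[kappa m - int r + 1 = k + 1] (mod int e)" by (rule cong_add) simp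
        then have "[residue e kappa (m, r, 1) = k + 1] (mod int e)"
          by (simp add: residue_def cong_def algebra_simps)
        then show False
          using hor c' lam \<open>c = 1\<close> by (auto simp: k_horizontal_def nodes_def)
      qed
      then obtain d where d: "c = Suc d" "1 \<le> d" using c'(1) by (cases c) auto
      then have "d \<in> ?K m r"
        using c' lam by (auto simp: k_nodes_def nodes_def residue_def algebra_simps)
      then show "c \<in> Suc ` ?K m r" using d by blast
    qed
    then have "card (?K m (r + 1)) \<le> card (Suc ` ?K m r)" by (intro card_mono) auto
    then show ?thesis by (simp add: card_image)
  qed
  have "Phi e kappa k lam m (r + 1) \<le> Phi e kappa k lam m r" if "1 \<le> r" for m r
    using le[OF that] mp that unfolding Phi_def multipartition_def by (intro add_mono) auto
  then show ?thesis
    using mp unfolding multipartition_def empty by blast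
qed

end

theory Submission
  imports Defs
begin

text \<open>
  The map \<open>\<phi>\<^sup>T\<close> leaves room for the extra entry of each \<open>A\<^sup>\<sharp>\<close>: if \<open>t < t'\<close>, then
  \<open>\<phi>\<^sup>T(t) < \<phi>\<^sup>T(t')\<close>, and even \<open>\<phi>\<^sup>T(t) + 1 < \<phi>\<^sup>T(t')\<close> if \<open>t\<close> is the entry of a \<open>k\<close>-node.
  This gives injectivity and increasing rows; bijectivity follows by counting. For columns,
  \<open>k\<close>-horizontality says that the \<open>k\<close>-nodes of row \<open>r + 1\<close> are those of row \<open>r\<close> moved one step to
  the right, as far as row \<open>r + 1\<close> reaches. Hence
  \<open>(m, r + 1, d + 1)\<^sup>+\<close> lies below \<open>(m, r, d)\<^sup>\<sharp>\<close> or below \<open>(m, r, d + 1)\<^sup>+\<close>,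
  and \<open>(m, r + 1, d + 1)\<^sup>\<sharp>\<close> lies below \<open>(m, r, d + 1)\<^sup>+\<close>.
\<close>

section \<open>Diagonals and neighbouring rows\<close>

text \<open>Residues are constant along diagonals, so only \<open>d = 0\<close> needs an argument.
  Column 0 contains no node, and a \<open>k\<close>-node \<open>(m, Suc r, 1)\<close> would give
  \<open>(m, r, 1)\<close> residue \<open>k + 1\<close>, against horizontality.\<close>

lemma k_node_Suc_Suc_iff:
  assumes mp: "multipartition l lam" and hor: "k_horizontal e kappa k lam"
    and k: "k \<in> {0..<int e}" and r: "1 \<le> r" and node: "(m, Suc r, Suc d) \<in> nodes lam"
  shows "(m, Suc r, Suc d) \<in> k_nodes e kappa k lam \<longleftrightarrow> (m, r, d) \<in> k_nodes e kappa k lam"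
proof (cases d)
  case 0
  have le: "lam m (Suc r) \<le> lam m r"
    using mp r by (simp add: multipartition_def)
  have "(m, Suc r, 1) \<notin> k_nodes e kappa k lam"
  proof
    assume "(m, Suc r, 1) \<in> k_nodes e kappa k lam"
    then have "[kappa m - int r = k] (mod int e)"
      using k by (simp add: k_nodes_def residue_def cong_def)
    then have "[kappa m - int r + 1 = k + 1] (mod int e)"
      by (rule cong_add) simp
    then have "[residue e kappa (m, r, 1) = k + 1] (mod int e)"
      by (simp add: residue_def cong_def algebra_simps)
    then show False
      using hor node le 0 by (auto simp: k_horizontal_def nodes_def)
  qed
  then show ?thesis
    using 0 by (simp add: k_nodes_def nodes_def)
next
  case (Suc d')
  have "lam m (Suc r) \<le> lam m r"
    using mp r by (simp add: multipartition_def)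
  then show ?thesis
    using node Suc by (auto simp: k_nodes_def nodes_def residue_def algebra_simps)
qed

text \<open>This identifies the node directly above a given \<open>plus_node\<close> or
  \<open>sharp_node\<close> of row \<open>Suc r\<close>. The columns \<open>f\<close> and
  \<open>g\<close> of the plus-nodes in the two rows have increments that agree along diagonals, so
  \<open>j = f d + 1\<close>.\<close>

lemma plus_node_Suc_row:
  assumes "multipartition l lam" and "k_horizontal e kappa k lam"
    and "k \<in> {0..<int e}" and "1 \<le> r" and "(m, Suc r, Suc d) \<in> nodes lam"
    and "plus_node e kappa k lam (m, Suc r, Suc d) = (m, Suc r, j)"
  shows "(if (m, r, d) \<in> k_nodes e kappa k lam then sharp_node e kappa k lam (m, r, d)
      else plus_node e kappa k lam (m, r, Suc d)) = (m, r, j)"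
    and "(m, Suc r, Suc d) \<in> k_nodes e kappa k lam \<Longrightarrow>
      plus_node e kappa k lam (m, r, Suc d) = (m, r, Suc j)"
proof -
  let ?K = "k_nodes e kappa k lam"
  obtain f where f: "\<And>c. plus_node e kappa k lam (m, r, c) = (m, r, f c)"
    "\<And>c. f (Suc c) = (if (m, r, c) \<in> ?K then f c + 2 else f c + 1)" "f 0 = 0"
    using plus_node_Suc by metis
  obtain g where g: "\<And>c. plus_node e kappa k lam (m, Suc r, c) = (m, Suc r, g c)"
    "\<And>c. g (Suc c) = (if (m, Suc r, c) \<in> ?K then g c + 2 else g c + 1)" "g 0 = 0"
    using plus_node_Suc by metis
  note shift = k_node_Suc_Suc_iff[OF assms(1-4)]
  \<comment> \<open>At \<open>c = 0\<close> both sides are 1, because column 0 contains no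
    \<open>k\<close>-node; afterwards \<open>shift\<close> equates the increments.\<close>
  have "g (Suc c) = f c + 1" if "(m, Suc r, Suc c) \<in> nodes lam" for c
    using that
  proof (induction c)
    case 0
    then show ?case
      using g(2)[of 0] g(3) f(3) by (simp add: k_nodes_def nodes_def)
  next
    case (Suc c)
    then have "(m, Suc r, Suc c) \<in> nodes lam"
      by (simp add: nodes_def)
    then show ?case
      using Suc.IH shift[of m c] by (simp add: f(2)[of c] g(2)[of "Suc c"])
  qed
  then have "j = f d + 1"
    using assms(5,6) g(1) by simp
  then show "(if (m, r, d) \<in> ?K then sharp_node e kappa k lam (m, r, d)
      else plus_node e kappa k lam (m, r, Suc d)) = (m, r, j)"
    and "(m, Suc r, Suc d) \<in> ?K \<Longrightarrow> plus_node e kappa k lam (m, r, Suc d) = (m, r, Suc j)"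
    using shift[OF assms(5)] by (simp_all add: f sharp_node_def)
qed

section \<open>Gaps in the values of \<open>phi\<close>\<close>

text \<open>The count added to \<open>t\<close> is monotone. If \<open>t\<close> belongs to a
  \<open>k\<close>-node, then \<open>t\<close> itself is counted for \<open>t'\<close> but not for
  \<open>t\<close>, which yields the extra 1.\<close>

lemma phi_less:
  assumes "t < t'"
  shows "phi e kappa k lam T t < phi e kappa k lam T t'"
    and "1 \<le> t \<Longrightarrow> residue e kappa (inv_into (nodes lam) T t) = k \<Longrightarrow>
      phi e kappa k lam T t + 1 < phi e kappa k lam T t'"
proof -
  define S where "S u = {j. 1 \<le> j \<and> j < u \<and> residue e kappa (inv_into (nodes lam) T j) = k}" for u
  have fin: "finite (S u)" for u
    by (rule finite_subset[of _ "{..u}"]) (auto simp: S_def)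
  have "card (S t) \<le> card (S t')"
    using assms by (intro card_mono fin) (auto simp: S_def)
  then show "phi e kappa k lam T t < phi e kappa k lam T t'"
    using assms by (simp add: phi_def S_def)
  assume t: "1 \<le> t" "residue e kappa (inv_into (nodes lam) T t) = k"
  have "card (insert t (S t)) \<le> card (S t')"
    using assms t by (intro card_mono fin) (auto simp: S_def)
  moreover have "t \<notin> S t"
    by (simp add: S_def)
  ultimately show "phi e kappa k lam T t + 1 < phi e kappa k lam T t'"
    using assms fin by (simp add: phi_def S_def)
qed

text \<open>The value \<open>phi (T A) + 1\<close> is the entry of \<open>sharp_node A\<close>. The
  bound \<open>t\<close> is arbitrary so that it can later be taken just above the largest entry of
  \<open>T\<close>.\<close>

lemma phi_less_k_node:
  assumes T: "tableau lam T" and A: "A \<in> k_nodes e kappa k lam" and less: "T A < t"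
  shows "phi e kappa k lam T (T A) + 1 < phi e kappa k lam T t"
proof -
  have "A \<in> nodes lam" and "residue e kappa A = k"
    using A by (auto simp: k_nodes_def)
  moreover from this(1) have "inv_into (nodes lam) T (T A) = A" and "1 \<le> T A"
    using T by (auto simp: tableau_def bij_betw_def inv_into_f_f)
  ultimately show ?thesis
    by (intro phi_less(2)[OF less]) simp_all
qed

lemma nodes_Phi_cases [consumes 1, case_names plus sharp]:
  assumes "(m, r, j) \<in> nodes (Phi e kappa k lam)"
  obtains c where "(m, r, c) \<in> nodes lam" and "(m, r, j) = plus_node e kappa k lam (m, r, c)"
  | c where "(m, r, c) \<in> k_nodes e kappa k lam" and "(m, r, j) = sharp_node e kappa k lam (m, r, c)"
proof -
  obtain A where "A \<in> nodes lam \<and> (m, r, j) = plus_node e kappa k lam A \<or>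
      A \<in> k_nodes e kappa k lam \<and> (m, r, j) = sharp_node e kappa k lam A"
    using assms unfolding nodes_Phi by blast
  then show thesis
    using that by (cases A) (auto simp: plus_node_def sharp_node_def)
qed

section \<open>Rows of the subdivided tableau\<close>

text \<open>By \<open>plus_node_less\<close>, the order of \<open>j\<close> and \<open>j'\<close>
  reflects back to the columns of the underlying nodes of \<open>lam\<close>, where \<open>T\<close>
  increases.\<close>

lemma subdivide_row_less:
  assumes T: "row_standard lam T"
    and B: "(m, r, j) \<in> nodes (Phi e kappa k lam)" and B': "(m, r, j') \<in> nodes (Phi e kappa k lam)"
    and "j < j'"
  shows "subdivide e kappa k lam T (m, r, j) < subdivide e kappa k lam T (m, r, j')"
proof -
  let ?K = "k_nodes e kappa k lam" and ?phi = "phi e kappa k lam T"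
  note less = plus_node_less[of _ _ e kappa k lam m r]
  have tab: "tableau lam T"
    using T by (simp add: row_standard_def)
  have row: "T (m, r, c) < T (m, r, c')"
    if "(m, r, c) \<in> nodes lam" "(m, r, c') \<in> nodes lam" "c < c'" for c c'
    using T that by (auto simp: row_standard_def)
  have K: "A \<in> nodes lam" if "A \<in> ?K" for A
    using that by (simp add: k_nodes_def)
  show ?thesis
    using B
  proof (cases rule: nodes_Phi_cases)
    case (plus c)
    note c = plus
    show ?thesis
      using B'
    proof (cases rule: nodes_Phi_cases)
      case (plus c')
      have "c < c'"
        using c(2)[symmetric] plus(2)[symmetric] \<open>j < j'\<close> less[of c' c]
        by (cases c c' rule: linorder_cases) auto
      then show ?thesis
        using c plus row by (simp add: subdivide_plus_node phi_less(1))
    next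
      case (sharp c')
      \<comment> \<open>Equality occurs for the two nodes made from one \<open>k\<close>-node; the
        \<open>+ 1\<close> at the sharp node then gives strictness.\<close>
      have "c \<le> c'"
        using c sharp \<open>j < j'\<close> less[of c' c]
        by (cases c c' rule: linorder_cases) (auto simp: sharp_node_def)
      then have "?phi (T (m, r, c)) \<le> ?phi (T (m, r, c'))"
        using row[OF c(1) K[OF sharp(1)]] phi_less(1) by (cases "c = c'") (auto intro: less_imp_le)
      then show ?thesis
        using c sharp by (simp add: subdivide_plus_node subdivide_sharp_node)
    qed
  next
    case (sharp c)
    note c = sharp
    show ?thesis
      using B'
    proof (cases rule: nodes_Phi_cases)
      case (plus c')
      \<comment> \<open>The left entry carries a \<open>+ 1\<close> here, so the larger gap after a
        \<open>k\<close>-node is required.\<close>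
      have "c < c'"
        using c(1) c(2)[symmetric] plus(2)[symmetric] \<open>j < j'\<close> less[of c' c]
        by (cases c c' rule: linorder_cases) (auto simp: sharp_node_def)
      then show ?thesis
        using c plus row K phi_less_k_node[OF tab c(1)]
        by (simp add: subdivide_plus_node subdivide_sharp_node)
    next
      case (sharp c')
      have "c < c'"
        using c(1) c(2)[symmetric] sharp(2)[symmetric] \<open>j < j'\<close> less[of c' c]
        by (cases c c' rule: linorder_cases) (auto simp: sharp_node_def)
      then show ?thesis
        using c sharp row K by (simp add: subdivide_sharp_node phi_less(1))
    qed
  qed
qed

section \<open>Columns of the subdivided tableau\<close>

lemma subdivide_column_Suc_less:
  assumes mp: "multipartition l lam" and hor: "k_horizontal e kappa k lam"
    and k: "k \<in> {0..<int e}" and T: "standard lam T" and r: "1 \<le> r"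
    and B: "(m, Suc r, j) \<in> nodes (Phi e kappa k lam)"
  shows "subdivide e kappa k lam T (m, r, j) < subdivide e kappa k lam T (m, Suc r, j)"
proof -
  let ?K = "k_nodes e kappa k lam" and ?phi = "phi e kappa k lam T"
  have tab: "tableau lam T"
    using T by (simp add: standard_def row_standard_def)
  have above: "(m, r, c) \<in> nodes lam" if "(m, Suc r, c) \<in> nodes lam" for c
  proof -
    have "lam m (Suc r) \<le> lam m r"
      using mp r by (simp add: multipartition_def)
    then show ?thesis
      using that by (simp add: nodes_def)
  qed
  have col: "T (m, r, c) < T (m, Suc r, c)" if "(m, Suc r, c) \<in> nodes lam" for c
    using T that above unfolding standard_def by blast
  show ?thesis
    using B
  proof (cases rule: nodes_Phi_cases)
    case (plus c)
    then obtain d where d: "c = Suc d"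
      by (cases c) (auto simp: nodes_def)
    note node = plus(1)[unfolded d] and j = plus(2)[unfolded d]
    note up = plus_node_Suc_row(1)[OF mp hor k r node j[symmetric]]
    show ?thesis
    proof (cases "(m, r, d) \<in> ?K")
      case True
      \<comment> \<open>The node above is the sharp node of \<open>(m, r, d)\<close>. One step right
        and one step down compare the entries of \<open>T\<close>, and the gap after a
        \<open>k\<close>-node absorbs the \<open>+ 1\<close>.\<close>
      then have "T (m, r, d) < T (m, r, Suc d)"
        using T above[OF node] by (auto simp: standard_def row_standard_def k_nodes_def)
      then have "T (m, r, d) < T (m, Suc r, Suc d)"
        using col[OF node] by simp
      then have "?phi (T (m, r, d)) + 1 < ?phi (T (m, Suc r, Suc d))"
        by (rule phi_less_k_node[OF tab True])
      then show ?thesis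
        using up True by (simp add: j subdivide_plus_node[OF node]
            subdivide_sharp_node[OF True] flip: up)
    next
      case False
      have "?phi (T (m, r, Suc d)) < ?phi (T (m, Suc r, Suc d))"
        by (rule phi_less(1)[OF col[OF node]])
      then show ?thesis
        using up False by (simp add: j subdivide_plus_node[OF node]
            subdivide_plus_node[OF above[OF node]] flip: up)
    qed
  next
    case (sharp c)
    then obtain d where d: "c = Suc d"
      by (cases c) (auto simp: nodes_def k_nodes_def)
    note kn = sharp(1)[unfolded d] and j = sharp(2)[unfolded d]
    have node: "(m, Suc r, Suc d) \<in> nodes lam"
      using kn by (simp add: k_nodes_def)
    obtain i where i: "plus_node e kappa k lam (m, Suc r, Suc d) = (m, Suc r, i)" "j = Suc i"
      using j by (auto simp: sharp_node_def split: prod.splits)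
    \<comment> \<open>Now the \<open>+ 1\<close> is in the lower row, so monotonicity of
      \<open>phi\<close> suffices.\<close>
    have "(m, r, j) = plus_node e kappa k lam (m, r, Suc d)"
      using plus_node_Suc_row(2)[OF mp hor k r node i(1) kn] i(2) by simp
    then have "subdivide e kappa k lam T (m, r, j) = ?phi (T (m, r, Suc d))"
      using subdivide_plus_node[OF above[OF node]] by simp
    then show ?thesis
      using phi_less(1)[OF col[OF node]] subdivide_sharp_node[OF kn] j
      by (metis less_SucI Suc_eq_plus1)
  qed
qed

text \<open>Adjacent rows are chained by induction. The intermediate nodes exist because
  \<open>Phi\<close> yields a multipartition, which again rests on horizontality.\<close>

lemma subdivide_column_less:
  assumes mp: "multipartition l lam" and hor: "k_horizontal e kappa k lam"
    and k: "k \<in> {0..<int e}" and T: "standard lam T" and r: "1 \<le> r" "r < r'"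
    and B: "(m, r', j) \<in> nodes (Phi e kappa k lam)"
  shows "subdivide e kappa k lam T (m, r, j) < subdivide e kappa k lam T (m, r', j)"
  using r(2) B
proof (induction r')
  case (Suc r')
  have r': "1 \<le> r'"
    using Suc.prems(1) r(1) by simp
  note step = subdivide_column_Suc_less[OF mp hor k T r' Suc.prems(2)]
  have "multipartition l (Phi e kappa k lam)"
    using multipartition_Phi[OF mp hor] k by simp
  then have "Phi e kappa k lam m (Suc r') \<le> Phi e kappa k lam m r'"
    using r' by (simp add: multipartition_def)
  then have "(m, r', j) \<in> nodes (Phi e kappa k lam)"
    using Suc.prems(2) by (simp add: nodes_def)
  then show ?case
    using Suc.IH Suc.prems(1) step by (cases "r = r'") auto
qed simp

section \<open>Bijectivity by counting\<close>

lemma card_nodes_Phi: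
  assumes "multipartition l lam"
  shows "card (nodes (Phi e kappa k lam)) = card (nodes lam) + card (k_nodes e kappa k lam)"
proof -
  have fin: "finite (nodes lam)" "finite (k_nodes e kappa k lam)"
    using card_nodes(1)[OF assms] by (auto simp: k_nodes_def)
  have "plus_node e kappa k lam ` nodes lam \<inter> sharp_node e kappa k lam ` k_nodes e kappa k lam = {}"
    using plus_node_neq_sharp_node by blast
  then show ?thesis
    unfolding nodes_Phi using fin
    by (simp add: card_Un_disjoint card_image inj_on_subset[OF inj_plus_node]
        inj_on_subset[OF inj_sharp_node])
qed

text \<open>One step past the largest entry, \<open>phi\<close> has counted every
  \<open>k\<close>-node, so its value is one more than the size of
  \<open>Phi e kappa k lam\<close>.\<close>

lemma phi_Suc_size:
  assumes T: "tableau lam T"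
  shows "phi e kappa k lam T (Suc (mp_size lam)) = Suc (mp_size lam + card (k_nodes e kappa k lam))"
proof -
  have bij: "bij_betw T (nodes lam) {1..mp_size lam}"
    using T by (simp add: tableau_def)
  then have inj: "inj_on T (nodes lam)"
    by (simp add: bij_betw_def)
  \<comment> \<open>The bounds on \<open>j\<close> describe exactly the image of \<open>T\<close>,
    where \<open>inv_into\<close> is a genuine inverse.\<close>
  have "{j. 1 \<le> j \<and> j < Suc (mp_size lam) \<and> residue e kappa (inv_into (nodes lam) T j) = k}
      = {j \<in> T ` nodes lam. residue e kappa (inv_into (nodes lam) T j) = k}"
    using bij by (auto simp: bij_betw_def)
  also have "\<dots> = T ` k_nodes e kappa k lam"
    using inj by (auto simp: k_nodes_def inv_into_f_f)
  finally show ?thesis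
    using card_image[OF inj_on_subset[OF inj]] by (simp add: phi_def k_nodes_def)
qed

text \<open>An injection from the diagram into \<open>{1..mp_size ?mu}\<close> is onto, since both
  sets have the same finite size.\<close>

lemma subdivide_tableau:
  assumes mp: "multipartition l lam" and mp': "multipartition l (Phi e kappa k lam)"
    and T: "tableau lam T"
  shows "tableau (Phi e kappa k lam) (subdivide e kappa k lam T)"
proof -
  let ?mu = "Phi e kappa k lam" and ?K = "k_nodes e kappa k lam"
    and ?phi = "phi e kappa k lam T" and ?T' = "subdivide e kappa k lam T"
  let ?P = "plus_node e kappa k lam" and ?S = "sharp_node e kappa k lam"
  have bij: "bij_betw T (nodes lam) {1..mp_size lam}"
    using T by (simp add: tableau_def)
  have K: "A \<in> nodes lam" if "A \<in> ?K" for A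
    using that by (simp add: k_nodes_def)
  have size: "mp_size ?mu = mp_size lam + card ?K"
    using card_nodes(2)[OF mp] card_nodes(2)[OF mp'] card_nodes_Phi[OF mp, of e kappa k] by simp
  have range: "T A \<in> {1..mp_size lam}" if "A \<in> nodes lam" for A
    using bij that by (auto simp: bij_betw_def)
  have entry: "\<exists>A \<in> nodes lam. B = ?P A \<and> ?T' B = ?phi (T A) \<or>
      A \<in> ?K \<and> B = ?S A \<and> ?T' B = ?phi (T A) + 1" if "B \<in> nodes ?mu" for B
    using that K unfolding nodes_Phi by (auto simp: subdivide_plus_node subdivide_sharp_node)
  have "?T' B \<noteq> ?T' B'" if B: "B \<in> nodes ?mu" "B' \<in> nodes ?mu" "B \<noteq> B'" for B B'
  proof -
    obtain A where A: "A \<in> nodes lam" "B = ?P A \<and> ?T' B = ?phi (T A) \<or>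
      A \<in> ?K \<and> B = ?S A \<and> ?T' B = ?phi (T A) + 1"
      using entry[OF B(1)] by blast
    obtain A' where A': "A' \<in> nodes lam" "B' = ?P A' \<and> ?T' B' = ?phi (T A') \<or>
      A' \<in> ?K \<and> B' = ?S A' \<and> ?T' B' = ?phi (T A') + 1"
      using entry[OF B(2)] by blast
    show ?thesis
    proof (cases "T A" "T A'" rule: linorder_cases)
      case less
      then show ?thesis
        using A A' phi_less(1)[OF less, of e kappa k lam T] phi_less_k_node[OF T _ less] by fastforce
    next
      \<comment> \<open>Distinct nodes over the same \<open>A\<close> are its plus node and its
        sharp node, whose entries differ by 1.\<close>
      case equal
      then have "A = A'"
        using bij A(1) A'(1) by (auto simp: bij_betw_def dest: inj_onD)
      then show ?thesis
        using A(2) A'(2) B(3) by auto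
    next
      case greater
      then show ?thesis
        using A A' phi_less(1)[OF greater, of e kappa k lam T] phi_less_k_node[OF T _ greater]
        by fastforce
    qed
  qed
  then have inj: "inj_on ?T' (nodes ?mu)"
    by (meson inj_onI)
  have "?T' B \<in> {1..mp_size ?mu}" if B: "B \<in> nodes ?mu" for B
  proof -
    obtain A where A: "A \<in> nodes lam" "B = ?P A \<and> ?T' B = ?phi (T A) \<or>
      A \<in> ?K \<and> B = ?S A \<and> ?T' B = ?phi (T A) + 1"
      using entry[OF B] by blast
    \<comment> \<open>Comparing with \<open>phi\<close> at this argument bounds both possible
      entries over \<open>A\<close> by \<open>mp_size ?mu\<close>.\<close>
    have less: "T A < Suc (mp_size lam)"
      using range[OF A(1)] by simp
    have "T A \<le> ?phi (T A)"
      by (simp add: phi_def)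
    then show ?thesis
      using range[OF A(1)] A(2) phi_less(1)[OF less, of e kappa k lam T]
        phi_less_k_node[OF T _ less, of e kappa k] phi_Suc_size[OF T, of e kappa k] size
      by fastforce
  qed
  then have "?T' ` nodes ?mu = {1..mp_size ?mu}"
    using card_image[OF inj] card_nodes(2)[OF mp'] by (intro card_subset_eq) auto
  then show ?thesis
    using inj by (simp add: tableau_def bij_betw_def)
qed

theorem proposition5p47:
  fixes e l :: nat and k :: int and kappa :: "nat \<Rightarrow> int"
    and lam mu :: parts and T T' :: "node \<Rightarrow> nat"
  assumes "e \<ge> 3" and "l \<ge> 1"
    and "k \<in> {0..<int e}"
    and "\<And>m. m \<in> {1..l} \<Longrightarrow> kappa m \<in> {0..<int e}"
    and "multipartition l lam"
    and "k_horizontal e kappa k lam"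
    and "row_standard lam T"
    and "mu = Phi e kappa k lam"
    and "T' = subdivide e kappa k lam T"
  shows "row_standard mu T' \<and> (standard lam T \<longrightarrow> standard mu T')"
proof -
  have mp': "multipartition l mu"
    using assms multipartition_Phi by simp
  have "tableau mu T'"
    using subdivide_tableau[of l lam e kappa k T] mp' assms by (simp add: row_standard_def)
  then have row: "row_standard mu T'"
    using subdivide_row_less[OF assms(7)] assms(8,9) by (simp add: row_standard_def)
  have "T' (m, r, c) < T' (m, r', c)"
    if std: "standard lam T" and nodes: "(m, r, c) \<in> nodes mu" "(m, r', c) \<in> nodes mu" "r < r'"
    for m r r' c
  proof -
    \<comment> \<open>Parts with row index 0 vanish in a multipartition.\<close>
    have "1 \<le> r"
      using mp' nodes(1) by (auto simp: multipartition_def nodes_def dest: spec[of _ m])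
    then show ?thesis
      using subdivide_column_less[OF assms(5,6,3) std _ nodes(3)] nodes(2) assms(8,9) by simp
  qed
  then show ?thesis
    using row unfolding standard_def by blast
qed

end
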